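(* Let $n\ge 2$ and let $\Gamma=\mathcal{P}_e(SD_{8n})$ be the enhanced power graph of the semidihedral group $SD_{8n}$. Then the detour eccentricity of a vertex $v$ of $\Gamma$ is \[ecc_D(v)=\begin{cases}4n+1, & v\in\{e,a^{2n}\},\\ 4n+2, & v\in\{a^{2i}b : 1\le i\le 2n\},\\ 4n+3, & v\in\{a^i : 1\le i\le 4n-1,\ i\ne 2n\}\cup\{a^{2i+1}b : 0\le i\le 2n-1\}.\end{cases}\]
   Context: For $n\ge 2$, the semidihedral group of order $8n$ is $SD_{8n}=\langle a,b : a^{4n}=b^2=e,\ ba=a^{2n-1}b\rangle$, with identity $e$; its elements are $a^i$ and $a^ib$ (exponents modulo $4n$). The enhanced power graph $\mathcal{P}_e(G)$ of a finite group $G$ is the simple undirected graph with vertex set $G$ in which two distinct vertices $x,y$ are adjacent if and only if $x,y\in\langle z\rangle$ for some $z\in G$. In a connected graph, the detour distance $d_D(u,v)$ is the length (number of edges) of a longest $u$–$v$ path (no repeated vertices). The detour eccentricity $ecc_D(u)$ is the maximum of $d_D(u,v)$ over all vertices $v$. *)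

theory Defs
  imports "HOL-Algebra.Generated_Groups" "Graph_Theory.Digraph_Component"
begin

section \<open>Groups given by generators and relations\<close>

text \<open>
  A word is a list of letters; the letter \<open>(x, True)\<close> stands for the generator \<open>x\<close> and
  \<open>(x, False)\<close> for its formal inverse. A relation is a pair of words to be identified.
\<close>

type_synonym 'g word = "('g \<times> bool) list"

inductive pres_eq :: "('g word \<times> 'g word) set \<Rightarrow> 'g word \<Rightarrow> 'g word \<Rightarrow> bool"
  for R :: "('g word \<times> 'g word) set" where
  refl: "pres_eq R u u"
| sym: "pres_eq R u v \<Longrightarrow> pres_eq R v u"
| trans: "pres_eq R u v \<Longrightarrow> pres_eq R v w \<Longrightarrow> pres_eq R u w"
| append: "pres_eq R u u' \<Longrightarrow> pres_eq R v v' \<Longrightarrow> pres_eq R (u @ v) (u' @ v')"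
| cancel: "pres_eq R [(x, s), (x, \<not> s)] []"
| relation: "(u, v) \<in> R \<Longrightarrow> pres_eq R u v"

definition pres_class :: "('g word \<times> 'g word) set \<Rightarrow> 'g word \<Rightarrow> 'g word set" where
  "pres_class R u = {w. pres_eq R u w}"

definition presented_group :: "('g word \<times> 'g word) set \<Rightarrow> 'g word set monoid" where
  "presented_group R =
     \<lparr>carrier = range (pres_class R),
      monoid.mult = (\<lambda>X Y. \<Union>u\<in>X. \<Union>v\<in>Y. pres_class R (u @ v)),
      one = pres_class R []\<rparr>"

definition pres_gen :: "('g word \<times> 'g word) set \<Rightarrow> 'g \<Rightarrow> 'g word set" where
  "pres_gen R x = pres_class R [(x, True)]"

lemma pres_class_eq_iff: "pres_class R u = pres_class R v \<longleftrightarrow> pres_eq R u v"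
  unfolding pres_class_def by (blast intro: pres_eq.refl pres_eq.sym pres_eq.trans)

lemma presented_group_mult:
  "pres_class R u \<otimes>\<^bsub>presented_group R\<^esub> pres_class R v = pres_class R (u @ v)"
  unfolding presented_group_def pres_class_def
  by (auto intro: pres_eq.refl pres_eq.trans pres_eq.append)

lemma pres_eq_inverse:
  "pres_eq R (rev (map (\<lambda>(x, s). (x, \<not> s)) u) @ u) []"
proof (induction u)
  case Nil
  then show ?case by (simp add: pres_eq.refl)
next
  case (Cons l u)
  obtain x s where l: "l = (x, s)" by (cases l)
  let ?v = "rev (map (\<lambda>(x, s). (x, \<not> s)) u)"
  have "pres_eq R [(x, \<not> s), (x, s)] []"
    using pres_eq.cancel[of R x "\<not> s"] by simp
  then have "pres_eq R (?v @ ([(x, \<not> s), (x, s)] @ u)) (?v @ ([] @ u))"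
    by (intro pres_eq.append pres_eq.refl)
  then show ?case
    using Cons.IH l by (auto intro: pres_eq.trans)
qed

lemma presented_group_carrier: "carrier (presented_group R) = range (pres_class R)"
  and presented_group_one: "\<one>\<^bsub>presented_group R\<^esub> = pres_class R []"
  by (simp_all add: presented_group_def)

lemma group_presented_group: "group (presented_group R)"
proof (rule groupI)
  fix X assume "X \<in> carrier (presented_group R)"
  then obtain u where X: "X = pres_class R u"
    by (auto simp: presented_group_carrier)
  let ?v = "rev (map (\<lambda>(x, s). (x, \<not> s)) u)"
  have "pres_class R ?v \<otimes>\<^bsub>presented_group R\<^esub> X = \<one>\<^bsub>presented_group R\<^esub>"
    unfolding X presented_group_mult presented_group_one
    by (simp add: pres_class_eq_iff pres_eq_inverse)
  then show "\<exists>Y\<in>carrier (presented_group R). Y \<otimes>\<^bsub>presented_group R\<^esub> X = \<one>\<^bsub>presented_group R\<^esub>"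
    by (auto simp: presented_group_carrier)
qed (auto simp: presented_group_carrier presented_group_one presented_group_mult)


section \<open>The semidihedral group\<close>

datatype sd_gen = GenA | GenB

definition sd_relations :: "nat \<Rightarrow> (sd_gen word \<times> sd_gen word) set" where
  "sd_relations n =
     (let a = (GenA, True); b = (GenB, True)
      in {(replicate (4 * n) a, []),
          ([b, b], []),
          ([b, a], replicate (2 * n - 1) a @ [b])})"

text \<open>The argument is \<open>n\<close>, not the order \<open>8 * n\<close> of the group.\<close>

definition SD :: "nat \<Rightarrow> sd_gen word set monoid" where
  "SD n = presented_group (sd_relations n)"

definition sd_a :: "nat \<Rightarrow> sd_gen word set" where
  "sd_a n = pres_gen (sd_relations n) GenA"

definition sd_b :: "nat \<Rightarrow> sd_gen word set" where
  "sd_b n = pres_gen (sd_relations n) GenB"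


section \<open>Enhanced power graphs\<close>

text \<open>
  Following the graph library, an undirected graph is a digraph with a symmetric set of arcs.
\<close>

definition enhanced_power_graph :: "('a, 'm) monoid_scheme \<Rightarrow> ('a, 'a \<times> 'a) pre_digraph" where
  "enhanced_power_graph G =
     \<lparr>verts = carrier G,
      arcs = {(x, y). x \<in> carrier G \<and> y \<in> carrier G \<and> x \<noteq> y \<and>
                (\<exists>z\<in>carrier G. x \<in> generate G {z} \<and> y \<in> generate G {z})},
      tail = fst,
      head = snd\<rparr>"

lemma graph_enhanced_power_graph:
  assumes "finite (carrier G)"
  shows "graph (enhanced_power_graph G)"
proof -
  have "finite (arcs (enhanced_power_graph G))"
    by (rule finite_subset[of _ "carrier G \<times> carrier G"])
       (auto simp: enhanced_power_graph_def assms)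
  then show ?thesis
    using assms
    by unfold_locales
       (auto simp: enhanced_power_graph_def arc_to_ends_def symmetric_conv)
qed


section \<open>Detour distance and detour eccentricity\<close>

text \<open>
  A path \<open>p\<close> is the list of its arcs, so \<open>length p\<close> is its number of edges. Both maxima are
  meaningful for finite connected graphs only.
\<close>

definition detour_dist :: "('a, 'b) pre_digraph \<Rightarrow> 'a \<Rightarrow> 'a \<Rightarrow> nat" where
  "detour_dist \<Gamma> u v = Max {length p | p. pre_digraph.apath \<Gamma> u p v}"

definition detour_ecc :: "('a, 'b) pre_digraph \<Rightarrow> 'a \<Rightarrow> nat" where
  "detour_ecc \<Gamma> u = Max {detour_dist \<Gamma> u v | v. v \<in> verts \<Gamma>}"

end

theory Submission
  imports Defs "HOL-Algebra.Multiplicative_Group"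
begin

text \<open>
  The cyclic subgroup \<open>A\<close> generated by \<open>a\<close> has order \<open>4 * n\<close>. Since \<open>(a\<^sup>kb)\<^sup>2 = a\<^sup>2\<^sup>n\<^sup>k\<close>, an element
  \<open>a\<^sup>kb\<close> is an involution for even \<open>k\<close>, and for odd \<open>k\<close> it has order 4 and square \<open>z = a\<^sup>2\<^sup>n\<close>. Hence the
  enhanced power graph consists of the clique \<open>A\<close>, of pendant vertices attached to the identity
  \<open>e\<close> (the involutions outside \<open>A\<close>), and of edges \<open>{q, qz}\<close> whose ends are joined to both \<open>e\<close> and
  \<open>z\<close> (the elements of order 4 outside \<open>A\<close>).

  The set \<open>{e, z}\<close> therefore separates the graph into the block \<open>R = A - {e, z}\<close> with
  \<open>4 * n - 2\<close> vertices and into blocks with one or two vertices. A path enters a new block only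
  after passing through \<open>e\<close> or \<open>z\<close>, so it visits at most three blocks, and only two if it starts in
  \<open>{e, z}\<close>. Counting \<open>R\<close>, the two cut vertices, and two vertices for each other block gives at
  most \<open>4 * n + 4\<close> vertices in general and \<open>4 * n + 2\<close> for a start in \<open>{e, z}\<close>
  (\<open>vpath_length_le\<close>). A path from a pendant vertex continues with a path from \<open>e\<close>, hence has at
  most \<open>4 * n + 3\<close> vertices. All bounds are attained, because for \<open>n \<ge> 2\<close> there are two different
  pairs \<open>{q, qz}\<close> with which to fill the blocks other than \<open>R\<close>.

  This computation is done for any graph of that shape (\<open>clique_with_ears\<close>). That the
  enhanced power graph has this shape is derived from the internal description of the group
  (\<open>common_cyclic_iff\<close>), and that the presented group satisfies this description follows from an
  action of words on \<open>\<int> \<times> bool\<close> modulo \<open>4 * n\<close>, which shows that the relations do not force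
  further identifications (\<open>semidihedral_SD\<close>).
\<close>

section \<open>Detour eccentricity in terms of vertex lists\<close>

definition vertex_path :: "('a, 'b) pre_digraph \<Rightarrow> ('a \<Rightarrow> 'a \<Rightarrow> bool) \<Rightarrow> 'a list \<Rightarrow> bool" where
  "vertex_path \<Gamma> adj vs \<longleftrightarrow> vs \<noteq> [] \<and> set vs \<subseteq> verts \<Gamma> \<and> distinct vs \<and> successively adj vs"

text \<open>
  When arcs are pairs of vertices, a path is determined by the list of vertices it visits, and
  this list has one entry more than the path has arcs. Lists of vertices are what the counting
  arguments below work with.
\<close>

locale arc_pair_digraph =
  fixes \<Gamma> :: "('a, 'a \<times> 'a) pre_digraph" and adj :: "'a \<Rightarrow> 'a \<Rightarrow> bool"
  assumes tail_eq: "tail \<Gamma> = fst" and head_eq: "head \<Gamma> = snd"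
    and arcs_adj: "(x, y) \<in> arcs \<Gamma> \<longleftrightarrow> x \<in> verts \<Gamma> \<and> y \<in> verts \<Gamma> \<and> adj x y"
begin

abbreviation "vpath \<equiv> vertex_path \<Gamma> adj"

lemma vertices_of_awalk:
  "u \<in> verts \<Gamma> \<Longrightarrow> set p \<subseteq> arcs \<Gamma> \<Longrightarrow> pre_digraph.cas \<Gamma> u p v \<Longrightarrow>
   set (pre_digraph.awalk_verts \<Gamma> u p) \<subseteq> verts \<Gamma> \<and>
   successively adj (pre_digraph.awalk_verts \<Gamma> u p) \<and>
   hd (pre_digraph.awalk_verts \<Gamma> u p) = u"
proof (induction p arbitrary: u)
  case Nil
  then show ?case by (simp add: pre_digraph.awalk_verts.simps)
next
  case (Cons x p)
  obtain y where x: "x = (u, y)" "adj u y" "y \<in> verts \<Gamma>"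
    using Cons.prems by (cases x) (auto simp: pre_digraph.cas.simps tail_eq arcs_adj)
  then show ?case
    using Cons.IH[of y] Cons.prems
    by (auto simp: pre_digraph.cas.simps pre_digraph.awalk_verts.simps
        tail_eq head_eq successively_Cons)
qed

lemma awalk_of_vertices:
  "set (u # vs) \<subseteq> verts \<Gamma> \<Longrightarrow> successively adj (u # vs) \<Longrightarrow>
   set (zip (u # vs) vs) \<subseteq> arcs \<Gamma> \<and>
   pre_digraph.cas \<Gamma> u (zip (u # vs) vs) (last (u # vs)) \<and>
   pre_digraph.awalk_verts \<Gamma> u (zip (u # vs) vs) = u # vs"
proof (induction vs arbitrary: u)
  case Nil
  then show ?case by (simp add: pre_digraph.cas.simps pre_digraph.awalk_verts.simps)
next
  case (Cons y vs)
  then show ?case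
    using Cons.IH[of y]
    by (auto simp: pre_digraph.cas.simps pre_digraph.awalk_verts.simps
        tail_eq head_eq arcs_adj)
qed

lemma vpath_of_apath:
  assumes "pre_digraph.apath \<Gamma> u p v"
  obtains vs where "vpath vs" "hd vs = u" "length vs = Suc (length p)"
proof
  let ?vs = "pre_digraph.awalk_verts \<Gamma> u p"
  show "length ?vs = Suc (length p)"
    by (rule pre_digraph.length_awalk_verts)
  then have "?vs \<noteq> []" by auto
  then show "vpath ?vs" "hd ?vs = u"
    using assms vertices_of_awalk[of u p v]
    by (auto simp: pre_digraph.apath_def pre_digraph.awalk_def vertex_path_def)
qed

lemma apath_of_vpath:
  assumes "vpath vs"
  obtains p where "pre_digraph.apath \<Gamma> (hd vs) p (last vs)" "length vs = Suc (length p)"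
proof
  obtain u ws where vs: "vs = u # ws"
    using assms by (cases vs) (auto simp: vertex_path_def)
  show "pre_digraph.apath \<Gamma> (hd vs) (zip vs (tl vs)) (last vs)"
    using assms awalk_of_vertices[of u ws] unfolding vs
    by (auto simp: pre_digraph.apath_def pre_digraph.awalk_def vertex_path_def)
  show "length vs = Suc (length (zip vs (tl vs)))"
    by (simp add: vs)
qed

text \<open>
  The three premises provide the upper bound, its attainment, and the nonemptiness of every set of
  path lengths whose maximum is a detour distance; the last is needed because a maximum over the
  empty set is unspecified.
\<close>

lemma detour_ecc_eqI:
  assumes bound: "\<And>vs. vpath vs \<Longrightarrow> hd vs = u \<Longrightarrow> length vs \<le> Suc K"
    and longest: "vpath ws" "hd ws = u" "length ws = Suc K"
    and connected: "\<And>v. v \<in> verts \<Gamma> \<Longrightarrow> \<exists>vs. vpath vs \<and> hd vs = u \<and> last vs = v"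
  shows "detour_ecc \<Gamma> u = K"
proof -
  define L where "L v = {length p | p. pre_digraph.apath \<Gamma> u p v}" for v
  have L_le: "L v \<subseteq> {..K}" for v
    unfolding L_def using bound by (force elim: vpath_of_apath)
  then have fin: "finite (L v)" for v
    using finite_subset by blast
  have dist: "detour_dist \<Gamma> u v = Max (L v)" for v
    by (simp add: detour_dist_def L_def)
  have dist_le: "detour_dist \<Gamma> u v \<le> K" if "v \<in> verts \<Gamma>" for v
  proof -
    have "L v \<noteq> {}"
      using connected[OF that] unfolding L_def by (auto elim!: apath_of_vpath)
    then have "Max (L v) \<in> L v"
      using fin by (rule Max_in[rotated])
    then show ?thesis using L_le dist by auto
  qed
  have "last ws \<in> verts \<Gamma>"
    using longest(1) by (auto simp: vertex_path_def)
  moreover have "K \<in> L (last ws)"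
    using apath_of_vpath[OF longest(1)] longest by (auto simp: L_def)
  then have "K \<le> detour_dist \<Gamma> u (last ws)"
    using fin dist by simp
  ultimately have "K = detour_dist \<Gamma> u (last ws)"
    using dist_le by (simp add: le_antisym)
  then show ?thesis
    unfolding detour_ecc_def using dist_le \<open>last ws \<in> verts \<Gamma>\<close>
    by (intro Max_eqI) (auto intro: finite_subset[of _ "{..K}"])
qed

end

section \<open>Longest paths in a clique with pairs attached to a two-vertex cut\<close>

text \<open>
  Let \<open>S\<close> separate the graph and let \<open>c\<close> be constant on each component of the complement of \<open>S\<close>.
  A path can change component only by passing through \<open>S\<close>, so each vertex of \<open>S\<close> on it opens at
  most one new component; a path starting outside \<open>S\<close> has one more, the component of its start.
\<close>

lemma card_blocks_visited_le:
  assumes "successively adj vs" "distinct vs"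
    and "\<And>x y. adj x y \<Longrightarrow> x \<notin> S \<Longrightarrow> y \<notin> S \<Longrightarrow> c x = c y"
  shows "card (c ` (set vs - S)) \<le> card (set vs \<inter> S) + (if vs = [] \<or> hd vs \<in> S then 0 else 1)"
  using assms(1,2)
proof (induction vs)
  case Nil
  then show ?case by simp
next
  case (Cons x vs)
  then have "successively adj vs"
    by (cases vs) auto
  with Cons have IH: "card (c ` (set vs - S)) \<le> card (set vs \<inter> S) + (if vs = [] \<or> hd vs \<in> S then 0 else 1)"
    by simp
  show ?case
  proof (cases "x \<in> S")
    case True
    then show ?thesis
      using IH Cons.prems by (auto simp: insert_Diff_if Int_insert_left split: if_splits)
  next
    case x: False
    show ?thesis
    proof (cases "vs = [] \<or> hd vs \<in> S")
      case True
      have "card (insert (c x) (c ` (set vs - S))) \<le> Suc (card (c ` (set vs - S)))"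
        by (rule card_insert_le_m1) auto
      then show ?thesis
        using True IH x by (auto simp: insert_Diff_if)
    next
      case False
      then have "c (hd vs) = c x" "hd vs \<in> set vs - S"
        using assms(3)[of x "hd vs"] x Cons.prems by (auto simp: successively_Cons)
      then have "c ` (insert x (set vs) - S) = c ` (set vs - S)"
        using x by (metis image_eqI image_insert insert_Diff_if insert_absorb)
      then show ?thesis
        using False IH x by simp
    qed
  qed
qed

text \<open>
  The shape of the enhanced power graph of a semidihedral group: \<open>{e, z} \<union> R\<close> is a clique; each
  pair \<open>{q, \<sigma> q}\<close> in \<open>Q\<close> is an edge joined to both \<open>e\<close> and \<open>z\<close>; and all other vertices are joined
  to \<open>e\<close> alone.
\<close>

definition ears_adj :: "'a \<Rightarrow> 'a \<Rightarrow> 'a set \<Rightarrow> 'a set \<Rightarrow> ('a \<Rightarrow> 'a) \<Rightarrow> 'a \<Rightarrow> 'a \<Rightarrow> bool" where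
  "ears_adj e z R Q \<sigma> x y \<longleftrightarrow> x \<noteq> y \<and>
     (x \<in> {e, z} \<union> R \<and> y \<in> {e, z} \<union> R \<or> x = e \<or> y = e \<or>
      x = z \<and> y \<in> Q \<or> x \<in> Q \<and> y = z \<or> x \<in> Q \<and> y = \<sigma> x)"

locale clique_with_ears =
  fixes \<Gamma> :: "('a, 'a \<times> 'a) pre_digraph" and e z :: 'a and R P Q :: "'a set" and \<sigma> :: "'a \<Rightarrow> 'a"
  assumes tail: "tail \<Gamma> = fst" and head: "head \<Gamma> = snd"
    and verts: "verts \<Gamma> = {e, z} \<union> R \<union> P \<union> Q"
    and arcs: "(x, y) \<in> arcs \<Gamma> \<longleftrightarrow> x \<in> verts \<Gamma> \<and> y \<in> verts \<Gamma> \<and> ears_adj e z R Q \<sigma> x y"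
    and finite_R: "finite R" and card_R: "2 \<le> card R"
    and disj: "e \<noteq> z" "e \<notin> R" "e \<notin> P" "e \<notin> Q" "z \<notin> R" "z \<notin> P" "z \<notin> Q"
      "R \<inter> P = {}" "R \<inter> Q = {}" "P \<inter> Q = {}"
    and partner: "q \<in> Q \<Longrightarrow> \<sigma> q \<in> Q" "q \<in> Q \<Longrightarrow> \<sigma> q \<noteq> q" "q \<in> Q \<Longrightarrow> \<sigma> (\<sigma> q) = q"
    and Q_nonempty: "Q \<noteq> {}"
    and other_pair: "q \<in> Q \<Longrightarrow> \<exists>q'\<in>Q. q' \<noteq> q \<and> q' \<noteq> \<sigma> q"
begin

abbreviation adj :: "'a \<Rightarrow> 'a \<Rightarrow> bool" where
  "adj \<equiv> ears_adj e z R Q \<sigma>"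

sublocale arc_pair_digraph \<Gamma> adj
  by unfold_locales (simp_all add: tail head arcs)

text \<open>
  On the complement of \<open>{e, z}\<close> this is the connected component of \<open>x\<close>.
\<close>

definition block :: "'a \<Rightarrow> 'a set" where
  "block x = (if x \<in> R then R else if x \<in> Q then {x, \<sigma> x} else {x})"

lemma block_eq:
  assumes "adj x y" "x \<notin> {e, z}" "y \<notin> {e, z}"
  shows "block x = block y"
  using assms partner disj by (auto simp: ears_adj_def block_def)

text \<open>
  Only the block \<open>R\<close> can have more than two elements, so a path that visits \<open>k\<close> blocks has at most
  \<open>2 + 2 * k + (card R - 2)\<close> vertices.
\<close>

lemma card_vpath_le:
  assumes "vpath vs"
  shows "length vs \<le> card R + 2 * card (block ` (set vs - {e, z}))"
proof -
  let ?C = "block ` (set vs - {e, z})"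
  have fin: "finite K" if "K \<in> ?C" for K
    using that finite_R by (auto simp: block_def split: if_splits)
  have "card K \<le> 2 + (if K = R then card R - 2 else 0)" if "K \<in> ?C" for K
    using that by (auto simp: block_def card_insert_if split: if_splits)
  then have "(\<Sum>K\<in>?C. card K) \<le> (\<Sum>K\<in>?C. 2 + (if K = R then card R - 2 else 0))"
    by (rule sum_mono)
  also have "\<dots> = 2 * card ?C + (\<Sum>K\<in>?C. if K = R then card R - 2 else 0)"
    by (simp only: sum.distrib) simp
  also have "\<dots> \<le> 2 * card ?C + (card R - 2)"
    by simp
  finally have blocks: "(\<Sum>K\<in>?C. card K) \<le> 2 * card ?C + (card R - 2)" .
  have "set vs \<subseteq> {e, z} \<union> \<Union>?C"
    by (auto simp: block_def)
  then have "card (set vs) \<le> card ({e, z} \<union> \<Union>?C)"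
    using fin by (intro card_mono) auto
  also have "\<dots> \<le> card {e, z} + card (\<Union>?C)"
    by (rule card_Un_le)
  also have "\<dots> \<le> 2 + (\<Sum>K\<in>?C. card K)"
    using fin by (intro add_mono card_Union_le_sum_card) (auto simp: disj)
  finally show ?thesis
    using assms blocks card_R by (simp add: vertex_path_def distinct_card)
qed

text \<open>
  With the two cut vertices \<open>e\<close> and \<open>z\<close>, at most three blocks are visited, and at most two if the
  path starts at one of them.
\<close>

lemma vpath_length_le:
  assumes "vpath vs"
  shows "length vs \<le> card R + (if hd vs \<in> {e, z} then 4 else 6)"
proof -
  have "card (set vs \<inter> {e, z}) \<le> card {e, z}"
    by (intro card_mono) auto
  also have "\<dots> = 2"
    by (simp add: disj)
  finally have "card (set vs \<inter> {e, z}) \<le> 2" .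
  moreover have "card (block ` (set vs - {e, z})) \<le>
      card (set vs \<inter> {e, z}) + (if vs = [] \<or> hd vs \<in> {e, z} then 0 else 1)"
    using assms block_eq by (intro card_blocks_visited_le[where adj = adj]) (auto simp: vertex_path_def)
  ultimately show ?thesis
    using card_vpath_le[OF assms] assms by (auto simp: vertex_path_def split: if_splits)
qed

text \<open>
  A pendant vertex is followed by \<open>e\<close>, so the bound for paths starting at \<open>e\<close> grows by one only.
\<close>

lemma vpath_from_pendant_length_le:
  assumes "vpath vs" "hd vs \<in> P"
  shows "length vs \<le> card R + 5"
proof -
  obtain p ws where vs: "vs = p # ws" "p \<in> P"
    using assms by (cases vs) (auto simp: vertex_path_def)
  show ?thesis
  proof (cases "ws = []")
    case False
    then have "vpath ws" "adj p (hd ws)"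
      using assms(1) by (auto simp: vs vertex_path_def successively_Cons)
    moreover from this have "hd ws = e"
      using vs disj by (auto simp: ears_adj_def)
    ultimately show ?thesis
      using vpath_length_le[of ws] vs by simp
  qed (simp add: vs)
qed

lemma vpath_exists_between:
  assumes "u \<in> verts \<Gamma>" "v \<in> verts \<Gamma>"
  shows "\<exists>vs. vpath vs \<and> hd vs = u \<and> last vs = v"
proof -
  have "vpath [u]" if "u = v"
    using assms by (simp add: vertex_path_def)
  moreover have "vpath [u, v]" if "u \<noteq> v" "u = e \<or> v = e"
    using assms that by (auto simp: vertex_path_def ears_adj_def)
  moreover have "vpath [u, e, v]" if "u \<noteq> v" "u \<noteq> e" "v \<noteq> e"
    using assms that verts by (auto simp: vertex_path_def ears_adj_def)
  ultimately show ?thesis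
    by (metis last.simps list.sel(1) list.distinct(1))
qed

lemma clique_list:
  assumes "X \<subseteq> R"
  obtains xs where "set xs = X" "distinct xs" "length xs = card X" "successively adj xs"
proof -
  obtain xs where xs: "set xs = X" "distinct xs"
    using finite_distinct_list assms finite_R finite_subset by metis
  have "sorted_wrt adj xs"
    using xs assms by (auto simp: sorted_wrt_iff_nth_less ears_adj_def nth_eq_iff_index_eq)
  then show ?thesis
    using that xs by (metis distinct_card successively_if_sorted_wrt)
qed

lemma R_enum:
  obtains rs where "set rs = R" "distinct rs" "length rs = card R" "successively adj rs" "rs \<noteq> []"
    "hd rs \<in> R"
proof -
  obtain rs where rs: "set rs = R" "distinct rs" "length rs = card R" "successively adj rs"
    using clique_list[OF subset_refl] by metis
  then have "rs \<noteq> []" using card_R by auto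
  then show thesis using that rs by (metis hd_in_set)
qed

text \<open>
  A path from one cut vertex that attains the bound: it first uses up a pair and then reaches
  \<open>R\<close> over the other cut vertex.
\<close>

lemma long_vpath_from_hub:
  assumes "{h, k} = {e, z}" "q \<in> Q" "set rs = R" "distinct rs" "successively adj rs" "rs \<noteq> []"
    "hd rs \<in> R"
  shows "vpath ([h, q, \<sigma> q, k] @ rs)"
  using assms disj partner[OF assms(2)]
  by (auto simp: vertex_path_def successively_append_iff successively_Cons ears_adj_def verts doubleton_eq_iff)

lemma detour_ecc_hub:
  assumes "u \<in> {e, z}"
  shows "detour_ecc \<Gamma> u = card R + 3"
proof -
  obtain q where q: "q \<in> Q" using Q_nonempty by blast
  obtain rs where rs: "set rs = R" "distinct rs" "length rs = card R" "successively adj rs" "rs \<noteq> []"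
    "hd rs \<in> R" using R_enum .
  obtain k where "{u, k} = {e, z}" using assms by auto
  then have path: "vpath ([u, q, \<sigma> q, k] @ rs)"
    using long_vpath_from_hub q rs by blast
  show ?thesis
  proof (rule detour_ecc_eqI[OF _ path])
    show "length vs \<le> Suc (card R + 3)" if "vpath vs" "hd vs = u" for vs
      using vpath_length_le[OF that(1)] that assms by simp
    show "\<exists>vs. vpath vs \<and> hd vs = u \<and> last vs = v" if "v \<in> verts \<Gamma>" for v
      using vpath_exists_between that assms verts by auto
  qed (simp_all add: rs)
qed

lemma detour_ecc_pendant:
  assumes "p \<in> P"
  shows "detour_ecc \<Gamma> p = card R + 4"
proof -
  obtain q where q: "q \<in> Q" using Q_nonempty by blast
  obtain rs where rs: "set rs = R" "distinct rs" "length rs = card R" "successively adj rs" "rs \<noteq> []"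
    "hd rs \<in> R" using R_enum .
  have "vpath ([e, q, \<sigma> q, z] @ rs)"
    using long_vpath_from_hub q rs by blast
  moreover have "p \<notin> set ([e, q, \<sigma> q, z] @ rs)"
    using assms disj partner(1)[OF q] q rs by auto
  ultimately have path: "vpath ([p, e, q, \<sigma> q, z] @ rs)"
    using assms disj verts by (auto simp: vertex_path_def ears_adj_def)
  show ?thesis
  proof (rule detour_ecc_eqI[OF _ path])
    show "length vs \<le> Suc (card R + 4)" if "vpath vs" "hd vs = p" for vs
      using vpath_from_pendant_length_le[OF that(1)] that assms by simp
    show "\<exists>vs. vpath vs \<and> hd vs = p \<and> last vs = v" if "v \<in> verts \<Gamma>" for v
      using vpath_exists_between that assms verts by auto
  qed (simp_all add: rs)
qed

lemma detour_ecc_generic: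
  assumes "u \<in> R \<union> Q"
  shows "detour_ecc \<Gamma> u = card R + 5"
proof -
  have "\<exists>ws. vpath ws \<and> hd ws = u \<and> length ws = card R + 6"
  proof (cases "u \<in> R")
    case True
    obtain rs where rs: "set rs = R - {u}" "distinct rs" "length rs = card (R - {u})"
      "successively adj rs"
      using clique_list[of "R - {u}"] by auto
    then have "length rs = card R - 1" using True finite_R by simp
    then have len: "length rs = card R - 1" "rs \<noteq> []" using card_R by auto
    then have ends: "hd rs \<in> R - {u}" "last rs \<in> R - {u}"
      using rs(1) hd_in_set last_in_set by metis+
    obtain q where q: "q \<in> Q" using Q_nonempty by blast
    obtain q' where q': "q' \<in> Q" "q' \<noteq> q" "q' \<noteq> \<sigma> q" using other_pair[OF q] by blast
    \<comment> \<open>Three blocks, separated by the two cut vertices: \<open>R\<close> and two pairs.\<close>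
    have "vpath (u # rs @ [e, q, \<sigma> q, z, q', \<sigma> q'])"
      using True rs ends len disj partner[OF q] partner[OF q'(1)] q q'
      by (auto simp: vertex_path_def successively_append_iff successively_Cons ears_adj_def verts)
    then show ?thesis
      using len card_R by (intro exI[of _ "u # rs @ [e, q, \<sigma> q, z, q', \<sigma> q']"]) auto
  next
    case False
    then have u: "u \<in> Q" using assms by blast
    obtain q' where q': "q' \<in> Q" "q' \<noteq> u" "q' \<noteq> \<sigma> u" using other_pair[OF u] by blast
    obtain rs where rs: "set rs = R" "distinct rs" "length rs = card R" "successively adj rs"
      "rs \<noteq> []" "hd rs \<in> R" using R_enum .
    \<comment> \<open>The same three blocks, now starting with the pair of \<open>u\<close>.\<close>
    have "vpath ([u, \<sigma> u, e, q', \<sigma> q', z] @ rs)"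
      using rs disj partner[OF u] partner[OF q'(1)] u q'
      by (auto simp: vertex_path_def successively_append_iff successively_Cons ears_adj_def verts)
    then show ?thesis
      using rs(3) by (intro exI[of _ "[u, \<sigma> u, e, q', \<sigma> q', z] @ rs"]) auto
  qed
  then obtain ws where ws: "vpath ws" "hd ws = u" "length ws = card R + 6" by blast
  show ?thesis
  proof (rule detour_ecc_eqI[OF _ ws(1,2)])
    show "length vs \<le> Suc (card R + 5)" if "vpath vs" for vs
      using vpath_length_le[OF that] by (simp split: if_splits)
    show "\<exists>vs. vpath vs \<and> hd vs = u \<and> last vs = v" if "v \<in> verts \<Gamma>" for v
      using vpath_exists_between that assms verts by auto
  qed (simp add: ws)
qed

end

section \<open>Cyclic subgroups of a semidihedral group\<close>

lemma (in group) generate_eq_powers_below: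
  assumes w: "w \<in> carrier G" and m: "w [^] (m::nat) = \<one>" "m > 0"
  shows "generate G {w} = (\<lambda>k. w [^] k) ` {..<m}"
proof -
  have "ord w \<noteq> 0"
    using m pow_eq_id[OF w, of m] by auto
  then have "generate G {w} = range (\<lambda>k::nat. w [^] k)"
    using generate_pow_nat[OF w] by auto
  moreover have "w [^] k = w [^] (k mod m)" for k
  proof -
    have "w [^] k = w [^] (m * (k div m) + k mod m)" by simp
    also have "\<dots> = (w [^] m) [^] (k div m) \<otimes> w [^] (k mod m)"
      using w by (simp only: nat_pow_mult nat_pow_pow)
    finally show ?thesis using w m by simp
  qed
  then have "w [^] k \<in> (\<lambda>k. w [^] k) ` {..<m}" for k :: nat
    using m(2) by (metis image_eqI lessThan_iff mod_less_divisor)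
  ultimately show ?thesis by auto
qed

text \<open>
  The semidihedral group of order \<open>8 * n\<close>, described internally: besides the relations, it is
  required that they do not collapse, that is, that \<open>a\<close> has full order and \<open>b\<close> lies outside the
  rotations.
\<close>

locale semidihedral_group = group G for G (structure) +
  fixes n :: nat and a b
  assumes n: "2 \<le> n" and a [simp]: "a \<in> carrier G" and b [simp]: "b \<in> carrier G"
    and ord_a: "ord a = 4 * n" and b_notin: "b \<notin> generate G {a}"
    and b_sq: "b \<otimes> b = \<one>" and b_a: "b \<otimes> a = a [^] (2 * n - 1) \<otimes> b"
    and generators: "generate G {a, b} = carrier G"
begin

definition A where "A = generate G {a}"

definition z where "z = a [^] (2 * n)"

text \<open>
  The elements outside \<open>A\<close> are separated by their squares: involutions, and elements of order 4
  with square \<open>z\<close>. They turn out to be the \<open>a\<^sup>kb\<close> with \<open>k\<close> even and odd respectively.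
\<close>

definition P where "P = {x \<in> carrier G - A. x \<otimes> x = \<one>}"

definition Q where "Q = {x \<in> carrier G - A. x \<otimes> x = z}"

lemma A_eq: "A = (\<lambda>k. a [^] k) ` {..<4 * n}"
  unfolding A_def using n by (intro generate_eq_powers_below) (simp_all add: pow_eq_id ord_a)

lemma pow_in_A [simp]: "a [^] (k::nat) \<in> A"
  unfolding A_def using ord_a n by (auto simp: generate_pow_nat)

lemma subgroup_A: "subgroup A G"
  unfolding A_def by (rule generate_is_subgroup) simp

lemma A_carrier: "x \<in> A \<Longrightarrow> x \<in> carrier G"
  using subgroup.mem_carrier[OF subgroup_A] .

lemma card_A: "card A = 4 * n"
  unfolding A_def using ord_a by (simp flip: generate_pow_card)

lemma finite_A: "finite A"
  by (simp add: A_eq)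

lemma pow_a_inj:
  assumes "i < 4 * n" "j < 4 * n" "a [^] i = a [^] j"
  shows "i = j"
  using inj_onD[OF ord_inj[OF a]] assms by (simp add: ord_a)

lemma b_pow: "b \<otimes> a [^] (k::nat) = a [^] ((2 * n - 1) * k) \<otimes> b"
proof (induction k)
  case (Suc k)
  have "b \<otimes> a [^] Suc k = (b \<otimes> a [^] k) \<otimes> a"
    by (simp add: m_assoc)
  also have "\<dots> = a [^] ((2 * n - 1) * k) \<otimes> (b \<otimes> a)"
    by (simp add: Suc m_assoc)
  also have "\<dots> = a [^] ((2 * n - 1) * k + (2 * n - 1)) \<otimes> b"
    by (simp add: b_a nat_pow_mult flip: m_assoc)
  also have "(2 * n - 1) * k + (2 * n - 1) = (2 * n - 1) * Suc k"
    by simp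
  finally show ?case .
qed simp

lemma reflection_mult: "(a [^] (i::nat) \<otimes> b) \<otimes> (a [^] (k::nat) \<otimes> b) = a [^] (i + (2 * n - 1) * k)"
proof -
  have "(a [^] i \<otimes> b) \<otimes> (a [^] k \<otimes> b) = a [^] i \<otimes> (b \<otimes> a [^] k) \<otimes> b"
    by (simp add: m_assoc)
  also have "\<dots> = a [^] i \<otimes> a [^] ((2 * n - 1) * k) \<otimes> (b \<otimes> b)"
    by (simp add: b_pow m_assoc)
  finally show ?thesis by (simp add: b_sq nat_pow_mult)
qed

text \<open>
  The exponent \<open>k + (2 * n - 1) * k = 2 * n * k\<close> is where the semidihedral relation, as opposed to
  the dihedral one, enters.
\<close>

lemma reflection_sq: "(a [^] (k::nat) \<otimes> b) \<otimes> (a [^] k \<otimes> b) = z [^] k"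
proof -
  have "k + (2 * n - 1) * k = 2 * n * k"
    using n by (cases n) auto
  then show ?thesis
    by (simp add: reflection_mult z_def nat_pow_pow)
qed

lemma z_sq: "z \<otimes> z = \<one>"
  by (simp add: z_def nat_pow_mult pow_eq_id ord_a)

lemma z_carrier [simp]: "z \<in> carrier G"
  by (simp add: z_def)

lemma z_in_A [simp]: "z \<in> A"
  by (simp add: z_def)

lemma z_neq_one: "z \<noteq> \<one>"
  using n by (auto simp: z_def pow_eq_id ord_a dest: dvd_imp_le)

lemma one_in_A [simp]: "\<one> \<in> A"
  using subgroup.one_closed[OF subgroup_A] .

lemma reflection_notin_A: "a [^] (k::nat) \<otimes> b \<notin> A"
proof
  assume "a [^] k \<otimes> b \<in> A"
  then have "inv (a [^] k) \<otimes> (a [^] k \<otimes> b) \<in> A"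
    using subgroup_A by (simp add: subgroup.m_closed subgroup.m_inv_closed)
  then have "b \<in> A"
    by (simp add: inv_solve_left flip: m_assoc)
  then show False using b_notin by (simp add: A_def)
qed

lemma even_reflection: "even k \<Longrightarrow> a [^] (k::nat) \<otimes> b \<in> P"
  by (auto simp: P_def reflection_notin_A reflection_sq nat_pow_mult simp flip: nat_pow_pow
      elim!: evenE)
     (simp add: numeral_2_eq_2 z_sq)

lemma odd_reflection: "odd k \<Longrightarrow> a [^] (k::nat) \<otimes> b \<in> Q"
  by (auto simp: Q_def reflection_notin_A reflection_sq nat_pow_mult simp flip: nat_pow_pow
      elim!: oddE)
     (simp add: numeral_2_eq_2 z_sq)

text \<open>
  The set of all \<open>a\<^sup>k\<close> and \<open>a\<^sup>kb\<close> contains the generators and their inverses and is closed under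
  multiplication, because \<open>b\<close> can be moved to the right past any rotation.
\<close>

lemma carrier_cases:
  assumes "x \<in> carrier G"
  obtains (rotation) "x \<in> A" | (reflection) k where "k < 4 * n" "x = a [^] k \<otimes> b"
proof -
  define N where "N = A \<union> (\<lambda>y. y \<otimes> b) ` A"
  have pow: "\<exists>k::nat. y = a [^] k" if "y \<in> A" for y
    using that by (auto simp: A_eq)
  have swap: "\<exists>y'\<in>A. b \<otimes> y = y' \<otimes> b" if "y \<in> A" for y
    using pow[OF that] b_pow pow_in_A by metis
  have inv_b: "inv b = b"
    by (rule inv_equality) (simp_all add: b_sq)
  have "x \<in> generate G {a, b}"
    using assms generators by simp
  then have "x \<in> N"
  proof (induction rule: generate.induct)
    case one
    then show ?case by (simp add: N_def)
  next
    case (incl h)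
    then show ?case
      using generate.incl[of a "{a}" G] by (auto simp: N_def A_def intro: image_eqI[of _ _ \<one>] generate.one)
  next
    case (inv h)
    then show ?case
      using generate.inv[of a "{a}" G] by (auto simp: inv_b N_def A_def intro: image_eqI[of _ _ \<one>] generate.one)
  next
    case (eng g h)
    note closed = subgroup.m_closed[OF subgroup_A]
    obtain s t where s: "s \<in> A" "g = s \<or> g = s \<otimes> b" and t: "t \<in> A" "h = t \<or> h = t \<otimes> b"
      using eng.IH by (auto simp: N_def)
    obtain t' where t': "t' \<in> A" "b \<otimes> t = t' \<otimes> b" using swap t by blast
    note car = A_carrier[OF s(1)] A_carrier[OF t(1)] A_carrier[OF t'(1)]
    have bt: "s \<otimes> b \<otimes> t = s \<otimes> t' \<otimes> b"
      using car t' by (simp add: m_assoc)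
    have "s \<otimes> b \<otimes> (t \<otimes> b) = s \<otimes> b \<otimes> t \<otimes> b"
      using car by (simp add: m_assoc)
    also have "\<dots> = s \<otimes> t' \<otimes> (b \<otimes> b)"
      unfolding bt using car by (simp add: m_assoc)
    finally have "s \<otimes> b \<otimes> (t \<otimes> b) = s \<otimes> t'"
      using car by (simp add: b_sq)
    moreover have "s \<otimes> (t \<otimes> b) = s \<otimes> t \<otimes> b"
      using car by (simp add: m_assoc)
    ultimately show ?case
      using s t bt closed[OF s(1) t(1)] closed[OF s(1) t'(1)] by (auto simp: N_def)
  qed
  then show thesis
    using rotation reflection by (auto simp: N_def A_eq)
qed

lemma carrier_eq: "carrier G = {\<one>, z} \<union> (A - {\<one>, z}) \<union> P \<union> Q"
  using even_reflection odd_reflection A_carrier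
  by (auto simp: P_def Q_def elim!: carrier_cases)

text \<open>
  Besides \<open>A\<close>, the maximal cyclic subgroups are \<open>{\<one>, p}\<close> for \<open>p \<in> P\<close> and, as shown further
  below, \<open>{\<one>, q, z, q \<otimes> z}\<close> for \<open>q \<in> Q\<close>.
\<close>

lemma generate_P: "p \<in> P \<Longrightarrow> generate G {p} = {\<one>, p}"
  using generate_eq_powers_below[of p 2]
  by (auto simp: P_def numeral_2_eq_2 lessThan_Suc)

lemma commute_Q: "q \<in> Q \<Longrightarrow> z \<otimes> q = q \<otimes> z"
  using m_assoc[of q q q] by (simp add: Q_def)

lemma generate_Q:
  assumes "q \<in> Q"
  shows "generate G {q} = {\<one>, q, z, q \<otimes> z}"
proof -
  have q: "q \<in> carrier G" "q \<otimes> q = z" "q [^] (2::nat) = z"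
    using assms by (auto simp: Q_def numeral_2_eq_2)
  have "q [^] (3::nat) = q \<otimes> z"
    using q commute_Q[OF assms] by (simp add: numeral_eq_Suc)
  moreover have "q [^] (4::nat) = z \<otimes> z"
    using q m_assoc[of z q q] by (simp add: numeral_eq_Suc)
  ultimately show ?thesis
    using generate_eq_powers_below[of q 4] q z_sq
    by (auto simp: numeral_eq_Suc lessThan_Suc commute_Q[OF assms])
qed

lemma times_z_in_Q:
  assumes "q \<in> Q"
  shows "q \<otimes> z \<in> Q" "q \<otimes> z \<noteq> q" "q \<otimes> z \<otimes> z = q"
proof -
  have q: "q \<in> carrier G" "q \<otimes> q = z" "q \<notin> A"
    using assms by (auto simp: Q_def)
  show zz: "q \<otimes> z \<otimes> z = q"
    using q by (simp add: m_assoc z_sq)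
  show "q \<otimes> z \<noteq> q"
    using q z_neq_one by (simp add: r_cancel_one)
  have "q \<otimes> z \<notin> A"
    using q zz subgroup.m_closed[OF subgroup_A, of "q \<otimes> z" z] by auto
  moreover have "q \<otimes> z \<otimes> (q \<otimes> z) = z"
  proof -
    have "q \<otimes> z \<otimes> (q \<otimes> z) = q \<otimes> (z \<otimes> q) \<otimes> z"
      using q by (simp add: m_assoc)
    also have "\<dots> = (q \<otimes> q) \<otimes> (z \<otimes> z)"
      unfolding commute_Q[OF assms] using q(1) by (simp only: m_assoc m_closed z_carrier)
    finally show ?thesis using q z_sq by simp
  qed
  ultimately show "q \<otimes> z \<in> Q"
    using q by (simp add: Q_def)
qed

text \<open>
  The elements \<open>ab\<close>, \<open>a\<^sup>3b\<close>, \<open>a\<^sup>5b\<close> are distinct because \<open>5 < 4 * n\<close>, and three elements do not fit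
  into one pair.
\<close>

lemma two_pairs_in_Q: "\<exists>q'\<in>Q. q' \<noteq> q \<and> q' \<noteq> q \<otimes> z"
proof -
  let ?F = "\<lambda>k::nat. a [^] k \<otimes> b"
  have inj: "inj_on ?F {..<4 * n}"
    by (auto intro!: inj_onI pow_a_inj)
  have "card (?F ` {1, 3, 5}) = card {1::nat, 3, 5}"
    using n by (intro card_image inj_on_subset[OF inj]) auto
  moreover have "?F ` {1, 3, 5} \<subseteq> Q"
    by (intro image_subsetI odd_reflection) auto
  moreover have "\<not> ?F ` {1, 3, 5} \<subseteq> {q, q \<otimes> z}"
  proof
    assume "?F ` {1, 3, 5} \<subseteq> {q, q \<otimes> z}"
    then have "card (?F ` {1, 3, 5}) \<le> card {q, q \<otimes> z}"
      by (intro card_mono) auto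
    also have "\<dots> \<le> 2" by (simp add: card_insert_if)
    finally show False using \<open>card (?F ` {1, 3, 5}) = card {1::nat, 3, 5}\<close> by simp
  qed
  ultimately show ?thesis by blast
qed

text \<open>
  A cyclic subgroup is contained in \<open>A\<close> or is one of the small ones above. Their pairs of distinct
  elements are the edges of the clique, the pendant edges, and the edges at the pairs in \<open>Q\<close>.
\<close>

lemma common_cyclic_iff:
  assumes "x \<in> carrier G" "y \<in> carrier G"
  shows "x \<noteq> y \<and> (\<exists>w\<in>carrier G. x \<in> generate G {w} \<and> y \<in> generate G {w}) \<longleftrightarrow>
         ears_adj \<one> z (A - {\<one>, z}) Q (\<lambda>q. q \<otimes> z) x y" (is "?L \<longleftrightarrow> ?R")
proof
  assume ?L
  then obtain w where w: "x \<noteq> y" "w \<in> carrier G" "x \<in> generate G {w}" "y \<in> generate G {w}"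
    by blast
  have "w \<in> A \<or> w \<in> P \<or> w \<in> Q" using w(2) carrier_eq by auto
  then consider "w \<in> A" | "w \<in> P" | "w \<in> Q" by blast
  then show ?R
  proof cases
    case 1
    then have "generate G {w} \<subseteq> A" using subgroup_A by (intro generate_subgroup_incl) auto
    then show ?thesis using w by (auto simp: ears_adj_def)
  next
    case 2
    then show ?thesis using w by (auto simp: ears_adj_def generate_P)
  next
    case 3
    then show ?thesis using w times_z_in_Q[OF 3] by (auto simp: ears_adj_def generate_Q)
  qed
next
  assume R: ?R
  have self: "w \<in> generate G {w}" "\<one> \<in> generate G {w}" for w
    by (auto intro: generate.intros)
  have Q: "q \<in> carrier G" if "q \<in> Q" for q using that by (simp add: Q_def)
  consider "x \<in> A" "y \<in> A" | "x = \<one>" | "y = \<one>" | "x = z" "y \<in> Q" | "x \<in> Q" "y = z"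
    | "x \<in> Q" "y = x \<otimes> z"
    using R by (auto simp: ears_adj_def)
  then have "\<exists>w\<in>carrier G. x \<in> generate G {w} \<and> y \<in> generate G {w}"
  proof cases
    case 1
    then show ?thesis using a unfolding A_def by blast
  qed (use self assms generate_Q in \<open>blast+\<close>)
  then show ?L using R by (simp add: ears_adj_def)
qed

sublocale power_graph: clique_with_ears "enhanced_power_graph G" \<one> z "A - {\<one>, z}" P Q "\<lambda>q. q \<otimes> z"
proof
  show "(x, y) \<in> arcs (enhanced_power_graph G) \<longleftrightarrow>
      x \<in> verts (enhanced_power_graph G) \<and> y \<in> verts (enhanced_power_graph G) \<and>
      ears_adj \<one> z (A - {\<one>, z}) Q (\<lambda>q. q \<otimes> z) x y" for x y
    using common_cyclic_iff[of x y] by (auto simp: enhanced_power_graph_def)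
  show "verts (enhanced_power_graph G) = {\<one>, z} \<union> (A - {\<one>, z}) \<union> P \<union> Q"
    by (simp add: enhanced_power_graph_def carrier_eq)
  show "2 \<le> card (A - {\<one>, z})"
    using card_A n z_neq_one finite_A by (simp add: card_Diff_subset)
  show "Q \<noteq> {}"
    using odd_reflection[of 1] by auto
  show "P \<inter> Q = {}"
    using z_neq_one by (auto simp: P_def Q_def)
qed (simp_all add: enhanced_power_graph_def z_neq_one z_neq_one[symmetric] finite_A
      times_z_in_Q two_pairs_in_Q, auto simp: P_def Q_def)

lemma card_R: "card (A - {\<one>, z}) = 4 * n - 2"
  using card_A z_neq_one finite_A by (simp add: card_Diff_subset)

end

section \<open>The presented group is semidihedral of full order\<close>

text \<open>
  That the presentation does not collapse is seen on a model: with \<open>(i, j)\<close> standing for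
  \<open>a\<^sup>i\<close> or \<open>a\<^sup>ib\<close> according to \<open>j\<close>, letters act as left multiplication. The first component is an
  unreduced integer, so words equal in the group act equally only up to \<open>sd_cong\<close>.
\<close>

fun sd_act :: "nat \<Rightarrow> sd_gen \<times> bool \<Rightarrow> int \<times> bool \<Rightarrow> int \<times> bool" where
  "sd_act n (GenA, s) (i, j) = (if s then i + 1 else i - 1, j)"
| "sd_act n (GenB, s) (i, j) = ((2 * int n - 1) * i, \<not> j)"

definition sd_cong :: "nat \<Rightarrow> int \<times> bool \<Rightarrow> int \<times> bool \<Rightarrow> bool" where
  "sd_cong n s t \<longleftrightarrow> 4 * int n dvd fst s - fst t \<and> snd s = snd t"

lemma sd_cong_sym: "sd_cong n s t \<Longrightarrow> sd_cong n t s"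
  by (auto simp: sd_cong_def dvd_diff_commute)

lemma sd_cong_trans: "sd_cong n s t \<Longrightarrow> sd_cong n t r \<Longrightarrow> sd_cong n s r"
  using dvd_add[of "4 * int n" "fst s - fst t" "fst t - fst r"] by (auto simp: sd_cong_def)

lemma sd_cong_act:
  assumes "sd_cong n s t"
  shows "sd_cong n (sd_act n l s) (sd_act n l t)"
proof -
  obtain x sg i j i' j' where eq: "l = (x, sg)" "s = (i, j)" "t = (i', j')"
    by (metis surj_pair)
  have "(2 * int n - 1) * i - (2 * int n - 1) * i' = (2 * int n - 1) * (i - i')"
    by (simp add: algebra_simps)
  then show ?thesis
    using assms by (cases x) (auto simp: eq sd_cong_def)
qed

lemma sd_cong_foldr: "sd_cong n s t \<Longrightarrow> sd_cong n (foldr (sd_act n) u s) (foldr (sd_act n) u t)"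
  by (induction u) (auto intro: sd_cong_act)

lemma funpow_act_GenA: "(sd_act n (GenA, True) ^^ k) (i, j) = (i + int k, j)"
  by (induction k) auto

text \<open>
  The factor \<open>2 * n - 1\<close> has square \<open>4 * n * (n - 1) + 1\<close>.
\<close>

lemma sd_act_sq: "sd_cong n (sd_act n (GenB, s) (sd_act n (GenB, t) r)) r"
proof -
  obtain i j where r: "r = (i, j)" by (cases r)
  have "(2 * int n - 1) * ((2 * int n - 1) * i) - i = 4 * int n * ((int n - 1) * i)"
    by (simp add: algebra_simps)
  then show ?thesis by (auto simp: r sd_cong_def)
qed

text \<open>
  Every defining relation holds for the action, so equality in the presented group implies equal
  action; words acting differently on \<open>(0, False)\<close> are thereby distinguished.
\<close>

lemma sd_act_respects:
  assumes "pres_eq (sd_relations n) u v" "n \<ge> 1"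
  shows "sd_cong n (foldr (sd_act n) u s) (foldr (sd_act n) v s)"
  using assms(1)
proof (induction arbitrary: s rule: pres_eq.induct)
  case (refl u)
  then show ?case by (simp add: sd_cong_def)
next
  case (sym u v)
  then show ?case by (simp add: sd_cong_sym)
next
  case (trans u v w)
  then show ?case by (blast intro: sd_cong_trans)
next
  case (append u u' v v')
  then show ?case
    using sd_cong_trans[OF sd_cong_foldr[OF append.IH(2)] append.IH(1)] by simp
next
  case (cancel x t)
  show ?case
  proof (cases x)
    case GenA
    then show ?thesis by (cases s) (simp add: sd_cong_def)
  next
    case GenB
    then show ?thesis using sd_act_sq by simp
  qed
next
  case (relation u v)
  obtain i j where s: "s = (i, j)" by (cases s)
  have int: "int (2 * n - 1) = 2 * int n - 1" using assms(2) by simp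
  consider "u = replicate (4 * n) (GenA, True)" "v = []"
    | "u = [(GenB, True), (GenB, True)]" "v = []"
    | "u = [(GenB, True), (GenA, True)]"
      "v = replicate (2 * n - 1) (GenA, True) @ [(GenB, True)]"
    using relation by (auto simp: sd_relations_def Let_def)
  then show ?case
  proof cases
    case 1
    then show ?thesis by (simp add: s funpow_act_GenA sd_cong_def)
  next
    case 2
    then show ?thesis using sd_act_sq[of n True True s] by simp
  next
    case 3
    have "foldr (sd_act n) u s = foldr (sd_act n) v s"
      unfolding 3 s foldr_append
      by (simp add: funpow_act_GenA int right_diff_distrib distrib_left del: One_nat_def)
    then show ?thesis by (simp add: sd_cong_def)
  qed
qed

lemma sd_a_pow: "sd_a n [^]\<^bsub>SD n\<^esub> (k::nat) = pres_class (sd_relations n) (replicate k (GenA, True))"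
proof (induction k)
  case 0
  then show ?case by (simp add: SD_def presented_group_one)
next
  case (Suc k)
  then show ?case
    by (simp add: SD_def sd_a_def pres_gen_def presented_group_mult nat_pow_def replicate_append_same)
qed

lemma group_SD: "group (SD n)"
  by (simp add: SD_def group_presented_group)

lemma generate_presented_group:
  "generate (presented_group R) (range (pres_gen R)) = carrier (presented_group R)"
proof -
  let ?G = "presented_group R"
  interpret group ?G by (rule group_presented_group)
  have gen: "pres_gen R x \<in> carrier ?G" for x
    by (simp add: presented_group_carrier pres_gen_def)
  have "pres_class R u \<in> generate ?G (range (pres_gen R))" for u
  proof (induction u)
    case Nil
    then show ?case
      using generate.one[of ?G] by (simp add: presented_group_one)
  next
    case (Cons l u)
    obtain x s where l: "l = (x, s)" by (cases l)
    have "pres_class R [(x, False)] \<otimes>\<^bsub>?G\<^esub> pres_gen R x = \<one>\<^bsub>?G\<^esub>"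
      using pres_eq.cancel[of R x False]
      by (simp add: pres_gen_def presented_group_mult presented_group_one pres_class_eq_iff)
    then have "inv\<^bsub>?G\<^esub> pres_gen R x = pres_class R [(x, False)]"
      using gen by (intro inv_equality) (auto simp: presented_group_carrier)
    then have "pres_class R [l] \<in> generate ?G (range (pres_gen R))"
      using generate.inv[of "pres_gen R x" "range (pres_gen R)" ?G]
        generate.incl[of "pres_gen R x" "range (pres_gen R)" ?G]
      by (cases s) (auto simp: l pres_gen_def)
    from generate.eng[OF this Cons] show ?case
      by (simp add: presented_group_mult)
  qed
  then show ?thesis
    using generate_incl[of "range (pres_gen R)"] gen by (auto simp: presented_group_carrier)
qed

lemma semidihedral_SD:
  assumes "n \<ge> 2"
  shows "semidihedral_group (SD n) n (sd_a n) (sd_b n)"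
proof -
  let ?R = "sd_relations n" and ?a = "(GenA, True)" and ?b = "(GenB, True)"
  interpret group "SD n" by (rule group_SD)
  have rel: "pres_class ?R (replicate (4 * n) ?a) = pres_class ?R []"
    "pres_class ?R [?b, ?b] = pres_class ?R []"
    "pres_class ?R [?b, ?a] = pres_class ?R (replicate (2 * n - 1) ?a @ [?b])"
    unfolding pres_class_eq_iff by (rule pres_eq.relation, simp add: sd_relations_def Let_def)+
  have car: "sd_a n \<in> carrier (SD n)" "sd_b n \<in> carrier (SD n)"
    by (auto simp: sd_a_def sd_b_def SD_def pres_gen_def presented_group_carrier)
  have act: "sd_cong n (foldr (sd_act n) u (0, False)) (foldr (sd_act n) v (0, False))"
    if "pres_class ?R u = pres_class ?R v" for u v
    using that assms by (intro sd_act_respects) (simp_all add: pres_class_eq_iff)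
  have one: "\<one>\<^bsub>SD n\<^esub> = pres_class ?R []"
    by (simp add: SD_def presented_group_one)
  have "sd_a n [^]\<^bsub>SD n\<^esub> (4 * n) = \<one>\<^bsub>SD n\<^esub>"
    by (simp add: sd_a_pow one rel)
  then have dvd: "ord (sd_a n) dvd 4 * n"
    using car pow_eq_id by simp
  have "pres_class ?R (replicate (ord (sd_a n)) ?a) = pres_class ?R []"
    using pow_ord_eq_1[OF car(1)] by (simp add: sd_a_pow one)
  from act[OF this] have "int (4 * n) dvd int (ord (sd_a n))"
    by (simp add: funpow_act_GenA sd_cong_def)
  then have "4 * n dvd ord (sd_a n)"
    by (simp only: of_nat_dvd_iff)
  then have ord: "ord (sd_a n) = 4 * n"
    using dvd dvd_antisym by blast
  have b_notin: "sd_b n \<notin> generate (SD n) {sd_a n}"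
  proof
    assume "sd_b n \<in> generate (SD n) {sd_a n}"
    then obtain k :: nat where "sd_b n = sd_a n [^]\<^bsub>SD n\<^esub> k"
      using ord assms car by (auto simp: generate_pow_nat)
    then have "pres_class ?R [?b] = pres_class ?R (replicate k ?a)"
      by (simp add: sd_a_pow) (simp add: sd_b_def pres_gen_def)
    from act[OF this] show False
      by (simp add: funpow_act_GenA sd_cong_def)
  qed
  have UNIV_gen: "(UNIV :: sd_gen set) = {GenA, GenB}"
    by (auto intro: sd_gen.exhaust)
  have "range (pres_gen ?R) = {sd_a n, sd_b n}"
    unfolding UNIV_gen by (simp add: sd_a_def sd_b_def)
  then have gens: "generate (SD n) {sd_a n, sd_b n} = carrier (SD n)"
    using generate_presented_group[of ?R] by (simp add: SD_def)
  show ?thesis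
  proof unfold_locales
    show "sd_b n \<otimes>\<^bsub>SD n\<^esub> sd_b n = \<one>\<^bsub>SD n\<^esub>"
      using rel by (simp add: sd_b_def pres_gen_def SD_def presented_group_mult presented_group_one)
    show "sd_b n \<otimes>\<^bsub>SD n\<^esub> sd_a n = sd_a n [^]\<^bsub>SD n\<^esub> (2 * n - 1) \<otimes>\<^bsub>SD n\<^esub> sd_b n"
      unfolding sd_a_pow
      using rel by (simp add: sd_a_def sd_b_def pres_gen_def SD_def presented_group_mult)
  qed (use assms car ord b_notin gens in auto)
qed

section \<open>Detour eccentricities of the semidihedral group\<close>

theorem theorem3p2:
  fixes n :: nat and v :: "sd_gen word set"
  defines "G \<equiv> SD n" and "a \<equiv> sd_a n" and "b \<equiv> sd_b n"
  defines "\<Gamma> \<equiv> enhanced_power_graph G"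
  defines "V1 \<equiv> {\<one>\<^bsub>G\<^esub>, a [^]\<^bsub>G\<^esub> (2 * n)}"
    and "V2 \<equiv> {a [^]\<^bsub>G\<^esub> (2 * i) \<otimes>\<^bsub>G\<^esub> b | i :: nat. 1 \<le> i \<and> i \<le> 2 * n}"
    and "V3 \<equiv> {a [^]\<^bsub>G\<^esub> i | i :: nat. 1 \<le> i \<and> i \<le> 4 * n - 1 \<and> i \<noteq> 2 * n} \<union>
              {a [^]\<^bsub>G\<^esub> (2 * i + 1) \<otimes>\<^bsub>G\<^esub> b | i :: nat. 0 \<le> i \<and> i \<le> 2 * n - 1}"
  assumes "n \<ge> 2" and "v \<in> verts \<Gamma>"
  shows "v \<in> V1 \<union> V2 \<union> V3 \<and>
         (v \<in> V1 \<longrightarrow> detour_ecc \<Gamma> v = 4 * n + 1) \<and>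
         (v \<in> V2 \<longrightarrow> detour_ecc \<Gamma> v = 4 * n + 2) \<and>
         (v \<in> V3 \<longrightarrow> detour_ecc \<Gamma> v = 4 * n + 3)"
proof -
  interpret semidihedral_group G n a b
    unfolding G_def a_def b_def by (rule semidihedral_SD) fact
  have v: "v \<in> carrier G"
    using assms(9) by (simp add: \<Gamma>_def enhanced_power_graph_def)
  have V1: "V1 = {\<one>\<^bsub>G\<^esub>, z}"
    by (simp add: V1_def z_def)
  have V2: "V2 \<subseteq> P"
    using even_reflection by (auto simp: V2_def)
  have "a [^]\<^bsub>G\<^esub> i \<notin> {\<one>\<^bsub>G\<^esub>, z}" if "1 \<le> i" "i \<le> 4 * n - 1" "i \<noteq> 2 * n" for i :: nat
  proof -
    have "i < 4 * n" using that by linarith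
    then show ?thesis
      using that pow_a_inj[of i 0] pow_a_inj[of i "2 * n"] by (auto simp: z_def)
  qed
  moreover have "a [^]\<^bsub>G\<^esub> (2 * i + 1) \<otimes>\<^bsub>G\<^esub> b \<in> Q" for i :: nat
    by (rule odd_reflection) simp
  ultimately have V3: "V3 \<subseteq> (A - {\<one>\<^bsub>G\<^esub>, z}) \<union> Q"
    by (auto simp: V3_def)
  have "v \<in> V1 \<union> V2 \<union> V3"
    using v
  proof (cases rule: carrier_cases)
    case rotation
    then obtain i where i: "i < 4 * n" "v = a [^]\<^bsub>G\<^esub> i"
      by (auto simp: A_eq)
    show ?thesis
    proof (cases "i = 0 \<or> i = 2 * n")
      case True
      then show ?thesis using i by (auto simp: V1_def)
    next
      case False
      then have "1 \<le> i \<and> i \<le> 4 * n - 1 \<and> i \<noteq> 2 * n" using i by auto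
      then show ?thesis using i(2) unfolding V3_def by blast
    qed
  next
    case (reflection k)
    show ?thesis
    proof (cases "even k")
      case True
      then obtain i where k: "k = 2 * i" by blast
      \<comment> \<open>In \<open>V2\<close> the element \<open>b\<close> itself appears with the exponent \<open>4 * n\<close> instead of \<open>0\<close>.\<close>
      have "v = a [^]\<^bsub>G\<^esub> (2 * (2 * n)) \<otimes>\<^bsub>G\<^esub> b" if "i = 0"
      proof -
        have "a [^]\<^bsub>G\<^esub> (2 * (2 * n)) = \<one>\<^bsub>G\<^esub>"
          by (simp add: pow_eq_id ord_a)
        then show ?thesis using reflection k that by simp
      qed
      then show ?thesis
        using reflection k \<open>n \<ge> 2\<close> unfolding V2_def
        by (cases "i = 0") (auto intro: exI[of _ "2 * n"] exI[of _ i])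
    next
      case False
      then obtain i where "k = 2 * i + 1" by (blast elim: oddE)
      then have "v = a [^]\<^bsub>G\<^esub> (2 * i + 1) \<otimes>\<^bsub>G\<^esub> b \<and> 0 \<le> i \<and> i \<le> 2 * n - 1"
        using reflection by auto
      then show ?thesis unfolding V3_def by blast
    qed
  qed
  moreover have "detour_ecc \<Gamma> v = 4 * n + 1" if "v \<in> V1"
    using power_graph.detour_ecc_hub[of v] that \<open>n \<ge> 2\<close> by (simp add: V1 \<Gamma>_def card_R)
  moreover have "detour_ecc \<Gamma> v = 4 * n + 2" if "v \<in> V2"
    using power_graph.detour_ecc_pendant[of v] that V2 \<open>n \<ge> 2\<close> by (auto simp: \<Gamma>_def card_R)
  moreover have "detour_ecc \<Gamma> v = 4 * n + 3" if "v \<in> V3"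
    using power_graph.detour_ecc_generic[of v] subsetD[OF V3 that] \<open>n \<ge> 2\<close>
    by (simp add: \<Gamma>_def card_R)
  ultimately show ?thesis by blast
qed

end
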